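(* For $x\in[0,1]$ consider the lower-level problem $$\min_{y\in\mathbb R^2}\ g(x,y)=(y_1+1)^2+0.1\,x\,y_2^4+(1-6x)\,y_2^2$$ subject to $h_1(x,y)=-y_1\le 0$, $h_2(x,y)=y_1-2\le 0$, $h_3(x,y)=y_2-6\le 0$, $h_4(x,y)=-y_2-6\le 0$. There exist a compact set $K\subset\mathbb R^2$ with $[0,2]\times[-6,6]\subset\operatorname{int}(K)$ and $\epsilon>0$ such that for any $C^2$ functions $s,r_1,\dots,r_4:[0,1]\times\mathbb R^2\to\mathbb R$ such that $|s|,\|\nabla_y s\|,\|\nabla^2_{yy}s\|_{\rm op},|r_i|,\|\nabla_y r_i\|,\|\nabla^2_{yy}r_i\|_{\rm op}$ ($i=1,2,3,4$) are all at most $\epsilon$ at every $(x,y)\in[0,1]\times K$, the perturbed problem $$\min_{y\in\mathbb R^2}\ \widetilde g(x,y)=g(x,y)+s(x,y)\quad\text{s.t.}\quad \widetilde h_i(x,y)=h_i(x,y)+r_i(x,y)\le 0,\ i=1,2,3,4,$$ fails to satisfy uniform SOSC over $x\in[0,1]$.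
   Context: KKT pair of the perturbed problem at $x$: $(y,\lambda)\in\mathbb R^2\times\mathbb R^4$ with $\nabla_y\widetilde g(x,y)+\sum_i\lambda_i\nabla_y\widetilde h_i(x,y)=0$, $\widetilde h_i(x,y)\le0$, $\lambda_i\ge0$, $\lambda_i\widetilde h_i(x,y)=0$ for all $i$. Lagrangian: $\widetilde{\mathcal L}(x,y,\lambda)=\widetilde g(x,y)+\sum_i\lambda_i\widetilde h_i(x,y)$. Critical cone at a KKT pair $(y^\ast,\lambda^\ast)$: $\mathcal C(x,y^\ast)=\{d\in\mathbb R^2:$ for all $i$ with $\widetilde h_i(x,y^\ast)=0$, $\nabla_y\widetilde h_i(x,y^\ast)^\top d=0$ if $\lambda_i^\ast>0$ and $\nabla_y\widetilde h_i(x,y^\ast)^\top d\le0$ if $\lambda_i^\ast=0\}$. Uniform SOSC over $x\in[0,1]$: there is $\sigma>0$, independent of $x$, such that for every $x\in[0,1]$ and every KKT pair $(y^\ast,\lambda^\ast)$ at $x$ with $y^\ast$ a local minimizer of the problem at $x$, $d^\top\nabla^2_{yy}\widetilde{\mathcal L}(x,y^\ast,\lambda^\ast)d\ge\sigma\|d\|^2$ for all $d\in\mathcal C(x,y^\ast)$. *)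

theory Defs
  imports "HOL-Analysis.Analysis"
begin

section \<open>Differential calculus\<close>

definition grad :: "('a::real_inner \<Rightarrow> real) \<Rightarrow> 'a \<Rightarrow> 'a" where
  "grad f y = (THE D. GDERIV f y :> D)"

definition hessian :: "(real^'n \<Rightarrow> real) \<Rightarrow> real^'n \<Rightarrow> real^'n^'n" where
  "hessian f y = jacobian (grad f) (at y)"

text \<open>Derivatives are taken within \<open>S\<close>, so that at boundary points of \<open>S\<close>
  they are one-sided and values of \<open>f\<close> off \<open>S\<close> are irrelevant. For \<open>S = {0..1} \<times> UNIV\<close>
  they are unique, as \<open>S\<close> is convex with nonempty interior.\<close>

definition C2_on :: "('a::real_normed_vector) set \<Rightarrow> ('a \<Rightarrow> real) \<Rightarrow> bool" where
  "C2_on S f \<longleftrightarrow>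
    (\<exists>(f' :: 'a \<Rightarrow> 'a \<Rightarrow>\<^sub>L real) (f'' :: 'a \<Rightarrow> 'a \<Rightarrow>\<^sub>L 'a \<Rightarrow>\<^sub>L real).
      (\<forall>z\<in>S. (f has_derivative blinfun_apply (f' z)) (at z within S)) \<and>
      (\<forall>z\<in>S. (f' has_derivative blinfun_apply (f'' z)) (at z within S)) \<and>
      continuous_on S f'')"

section \<open>Parametric constrained minimization: minimize \<open>g x\<close> subject to \<open>h i x \<le> 0\<close>\<close>

definition feasible :: "('m \<Rightarrow> 'p \<Rightarrow> real^'n \<Rightarrow> real) \<Rightarrow> 'p \<Rightarrow> (real^'n) set" where
  "feasible h x = {y. \<forall>i. h i x y \<le> 0}"

definition local_minimizer ::
  "('p \<Rightarrow> real^'n \<Rightarrow> real) \<Rightarrow> ('m \<Rightarrow> 'p \<Rightarrow> real^'n \<Rightarrow> real) \<Rightarrow> 'p \<Rightarrow> real^'n \<Rightarrow> bool" where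
  "local_minimizer g h x y \<longleftrightarrow>
    y \<in> feasible h x \<and> (\<exists>e>0. \<forall>z \<in> feasible h x \<inter> ball y e. g x y \<le> g x z)"

definition KKT_pair ::
  "('p \<Rightarrow> real^'n \<Rightarrow> real) \<Rightarrow> ('m::finite \<Rightarrow> 'p \<Rightarrow> real^'n \<Rightarrow> real) \<Rightarrow> 'p \<Rightarrow> real^'n \<Rightarrow> real^'m \<Rightarrow> bool"
  where
  "KKT_pair g h x y \<mu> \<longleftrightarrow>
    grad (g x) y + (\<Sum>i\<in>UNIV. \<mu> $ i *\<^sub>R grad (h i x) y) = 0 \<and>
    (\<forall>i. h i x y \<le> 0 \<and> \<mu> $ i \<ge> 0 \<and> \<mu> $ i * h i x y = 0)"

definition lagrangian ::
  "('p \<Rightarrow> real^'n \<Rightarrow> real) \<Rightarrow> ('m::finite \<Rightarrow> 'p \<Rightarrow> real^'n \<Rightarrow> real) \<Rightarrow> 'p \<Rightarrow> real^'n \<Rightarrow> real^'m \<Rightarrow> real"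
  where
  "lagrangian g h x y \<mu> = g x y + (\<Sum>i\<in>UNIV. \<mu> $ i * h i x y)"

definition critical_cone ::
  "('m \<Rightarrow> 'p \<Rightarrow> real^'n \<Rightarrow> real) \<Rightarrow> 'p \<Rightarrow> real^'n \<Rightarrow> real^'m \<Rightarrow> (real^'n) set" where
  "critical_cone h x y \<mu> =
    {d. \<forall>i. h i x y = 0 \<longrightarrow>
      (\<mu> $ i > 0 \<longrightarrow> grad (h i x) y \<bullet> d = 0) \<and>
      (\<mu> $ i = 0 \<longrightarrow> grad (h i x) y \<bullet> d \<le> 0)}"

definition uniform_SOSC ::
  "'p set \<Rightarrow> ('p \<Rightarrow> real^'n \<Rightarrow> real) \<Rightarrow> ('m::finite \<Rightarrow> 'p \<Rightarrow> real^'n \<Rightarrow> real) \<Rightarrow> bool" where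
  "uniform_SOSC X g h \<longleftrightarrow>
    (\<exists>\<sigma>>0. \<forall>x\<in>X. \<forall>y \<mu>. KKT_pair g h x y \<mu> \<and> local_minimizer g h x y \<longrightarrow>
      (\<forall>d\<in>critical_cone h x y \<mu>.
        d \<bullet> (hessian (\<lambda>z. lagrangian g h x z \<mu>) y *v d) \<ge> \<sigma> * (norm d)\<^sup>2))"

section \<open>The lower-level problem\<close>

definition g0 :: "real \<Rightarrow> real^2 \<Rightarrow> real" where
  "g0 x y = (y$1 + 1)^2 + 0.1 * x * (y$2)^4 + (1 - 6 * x) * (y$2)^2"

text \<open>The index type \<open>4\<close> consists of \<open>1, 2, 3\<close> and \<open>4 = 0\<close>.\<close>

definition h0 :: "4 \<Rightarrow> real \<Rightarrow> real^2 \<Rightarrow> real" where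
  "h0 i x y =
    (if i = 1 then - y$1 else if i = 2 then y$1 - 2 else if i = 3 then y$2 - 6 else - y$2 - 6)"

definition C2_small :: "real \<Rightarrow> (real^'n) set \<Rightarrow> real set \<Rightarrow> (real \<Rightarrow> real^'n \<Rightarrow> real) \<Rightarrow> bool" where
  "C2_small \<epsilon> K X f \<longleftrightarrow>
    (\<forall>x\<in>X. \<forall>y\<in>K. \<bar>f x y\<bar> \<le> \<epsilon> \<and> norm (grad (f x) y) \<le> \<epsilon> \<and>
      onorm (\<lambda>d. hessian (f x) y *v d) \<le> \<epsilon>)"

end

theory Submission
  imports Defs
begin

text \<open>Near the edge \<open>y\<^sub>1 = 0\<close> the perturbed constraint \<open>h\<^sub>1 + r\<^sub>1 = 0\<close> is a graph \<open>y\<^sub>1 = \<phi> x y\<^sub>2\<close> and the perturbed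
  objective increases in \<open>y\<^sub>1\<close>, so local minimizers of \<open>t \<mapsto> G x t\<close>, the objective along the graph, are
  local minimizers of the perturbed problem. The second derivative of \<open>G x\<close> is the quadratic form of the
  Lagrangian Hessian in the tangent direction, which spans the critical cone; hence uniform SOSC makes all
  minimizers of \<open>G x\<close> uniformly nondegenerate. Then their number could not change with \<open>x\<close>; but \<open>G 0\<close> is
  strictly convex, whereas \<open>G 1\<close> is a double well (the unperturbed problem has a pitchfork bifurcation
  at \<open>x = 1/6\<close>).\<close>

section \<open>Nondegenerate minimizers of a one-parameter family\<close>

text \<open>A minimum over \<open>[u, v]\<close> exists by compactness, and the signs of
  \<open>\<psi>\<close> make \<open>G\<close> decrease inward from both ends. The minimizer is
  therefore interior, hence an unconstrained local minimizer.\<close>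

lemma interior_minimizer_between_descents:
  fixes G \<psi> :: "real \<Rightarrow> real"
  assumes deriv: "\<And>t. u \<le> t \<Longrightarrow> t \<le> v \<Longrightarrow> (G has_real_derivative \<psi> t) (at t)"
    and "u < v" "\<psi> u < 0" "\<psi> v > 0"
  obtains t e where "u < t" "t < v" "\<psi> t = 0" "e > 0" "\<And>w. \<bar>w - t\<bar> < e \<Longrightarrow> G t \<le> G w"
proof -
  have "continuous_on {u..v} G"
    by (meson DERIV_isCont atLeastAtMost_iff continuous_at_imp_continuous_on deriv)
  then obtain t where t: "t \<in> {u..v}" and tmin: "\<And>w. w \<in> {u..v} \<Longrightarrow> G t \<le> G w"
    using continuous_attains_inf[of "{u..v}" G] \<open>u < v\<close> by auto
  have "t \<noteq> u"
  proof
    assume "t = u"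
    obtain d where d: "d > 0" "\<And>h. h > 0 \<Longrightarrow> h < d \<Longrightarrow> G (u + h) < G u"
      using DERIV_neg_dec_right[OF deriv, of u] \<open>u < v\<close> \<open>\<psi> u < 0\<close> by auto
    define h where "h = min (d / 2) (v - u)"
    have "h > 0" "h < d" "u + h \<in> {u..v}"
      using d(1) \<open>u < v\<close> by (auto simp: h_def min_def)
    then show False
      using d(2)[of h] tmin[of "u + h"] \<open>t = u\<close> by simp
  qed
  moreover have "t \<noteq> v"
  proof
    assume "t = v"
    obtain d where d: "d > 0" "\<And>h. h > 0 \<Longrightarrow> h < d \<Longrightarrow> G (v - h) < G v"
      using DERIV_pos_inc_left[OF deriv, of v] \<open>u < v\<close> \<open>\<psi> v > 0\<close> by auto
    define h where "h = min (d / 2) (v - u)"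
    have "h > 0" "h < d" "v - h \<in> {u..v}"
      using d(1) \<open>u < v\<close> by (auto simp: h_def min_def)
    then show False
      using d(2)[of h] tmin[of "v - h"] \<open>t = v\<close> by simp
  qed
  ultimately have tuv: "u < t" "t < v" using t by auto
  define e where "e = min (t - u) (v - t)"
  have e: "e > 0" "\<And>w. \<bar>w - t\<bar> < e \<Longrightarrow> G t \<le> G w"
    using tuv by (auto simp: e_def intro!: tmin)
  moreover have "\<psi> t = 0"
    using DERIV_local_min[OF deriv e(1), of t] e(2) tuv by (auto simp: abs_minus_commute)
  ultimately show ?thesis using tuv that by blast
qed

text \<open>The strict signs at \<open>u\<close> and \<open>v\<close>, unlike the zero itself,
  survive a small change of \<open>f\<close>; this lets zeros be continued in a parameter.\<close>

lemma sign_change_at_simple_zero: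
  fixes f :: "real \<Rightarrow> real"
  assumes "(f has_real_derivative D) (at t)" "D > 0" "f t = 0" "e > 0"
  obtains u v where "t - e < u" "u < t" "t < v" "v < t + e" "f u < 0" "f v > 0"
proof -
  obtain d where d: "d > 0" "\<And>h. h > 0 \<Longrightarrow> h < d \<Longrightarrow> f (t - h) < f t"
    using DERIV_pos_inc_left[OF assms(1,2)] by auto
  obtain d' where d': "d' > 0" "\<And>h. h > 0 \<Longrightarrow> h < d' \<Longrightarrow> f t < f (t + h)"
    using DERIV_pos_inc_right[OF assms(1,2)] by auto
  define h where "h = min (min d d') e / 2"
  have "h > 0" "h < d" "h < d'" "h < e"
    using \<open>e > 0\<close> d(1) d'(1) by (auto simp: h_def)
  then show ?thesis
    using that[of "t - h" "t + h"] d(2)[of h] d'(2)[of h] assms(3) by simp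
qed

text \<open>The parameters admitting two nondegenerate minimizers form a compact set: by Rolle and uniform
  continuity of \<open>D\<close>, two such minimizers keep a fixed distance. Each of them persists for nearby
  parameters, so the least element of that set could only be \<open>0\<close>.\<close>

lemma no_uniformly_nondegenerate_family:
  fixes G \<psi> D :: "real \<Rightarrow> real \<Rightarrow> real"
  assumes G: "\<And>x t. x \<in> {0..1} \<Longrightarrow> t \<in> {-l..l} \<Longrightarrow> (G x has_real_derivative \<psi> x t) (at t)"
    and \<psi>: "\<And>x t. x \<in> {0..1} \<Longrightarrow> t \<in> {-l..l} \<Longrightarrow> (\<psi> x has_real_derivative D x t) (at t)"
    and cont: "continuous_on ({0..1} \<times> {-l..l}) (\<lambda>(x, t). \<psi> x t)"
      "continuous_on ({0..1} \<times> {-l..l}) (\<lambda>(x, t). D x t)"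
    and ends: "\<And>x. x \<in> {0..1} \<Longrightarrow> \<psi> x (-l) < 0 \<and> \<psi> x l > 0"
    and convex: "\<And>t. t \<in> {-l..l} \<Longrightarrow> D 0 t > 0"
    and bistable: "-l < a1" "a1 < b1" "b1 < l" "\<psi> 1 a1 > 0" "\<psi> 1 b1 < 0"
    and "m > 0"
    and nondeg: "\<And>x t e. x \<in> {0..1} \<Longrightarrow> -l < t \<Longrightarrow> t < l \<Longrightarrow> e > 0 \<Longrightarrow>
      (\<And>w. \<bar>w - t\<bar> < e \<Longrightarrow> G x t \<le> G x w) \<Longrightarrow> D x t \<ge> m"
  shows False
proof -
  \<comment> \<open>\<open>Z\<close> replaces local minimality by closed conditions;
    \<open>nondeg\<close> supplies the bound \<open>D x t \<ge> m\<close> at every interior local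
    minimizer.\<close>
  define Z where "Z x t \<longleftrightarrow> t \<in> {-l..l} \<and> \<psi> x t = 0 \<and> D x t \<ge> m" for x t
  define S where "S = {x \<in> {0..1}. \<exists>a b. a < b \<and> Z x a \<and> Z x b}"
  have Z_between: "\<exists>t. u < t \<and> t < v \<and> Z x t"
    if "x \<in> {0..1}" "-l \<le> u" "u < v" "v \<le> l" "\<psi> x u < 0" "\<psi> x v > 0" for x u v
  proof -
    have der: "(G x has_real_derivative \<psi> x t) (at t)" if "u \<le> t" "t \<le> v" for t
      using that \<open>-l \<le> u\<close> \<open>v \<le> l\<close> by (intro G \<open>x \<in> {0..1}\<close>) auto
    obtain t e where t: "u < t" "t < v" "\<psi> x t = 0" "e > 0"
      "\<And>w. \<bar>w - t\<bar> < e \<Longrightarrow> G x t \<le> G x w"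
      by (rule interior_minimizer_between_descents[OF der \<open>u < v\<close> \<open>\<psi> x u < 0\<close> \<open>\<psi> x v > 0\<close>]) blast+
    then have "D x t \<ge> m" using that by (intro nondeg[of x t e]) auto
    with t that show ?thesis by (auto simp: Z_def)
  qed
  have two_zeros: "\<exists>\<xi>. a < \<xi> \<and> \<xi> < b \<and> D x \<xi> = 0"
    if "x \<in> {0..1}" "a < b" "Z x a" "Z x b" for x a b
  proof -
    have der: "(\<psi> x has_real_derivative D x t) (at t)" if "a \<le> t" "t \<le> b" for t
      using \<open>Z x a\<close> \<open>Z x b\<close> that by (intro \<psi> \<open>x \<in> {0..1}\<close>) (auto simp: Z_def)
    obtain \<xi> where "a < \<xi>" "\<xi> < b" "\<psi> x b - \<psi> x a = (b - a) * D x \<xi>"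
      using MVT2[OF \<open>a < b\<close> der] by auto
    then show ?thesis using that by (auto simp: Z_def)
  qed
  have "uniformly_continuous_on ({0..1} \<times> {-l..l}) (\<lambda>(x, t). D x t)"
    by (intro compact_uniformly_continuous cont compact_Times) auto
  then obtain \<delta> where "\<delta> > 0" and \<delta>: "\<And>p p'. p \<in> {0..1} \<times> {-l..l} \<Longrightarrow> p' \<in> {0..1} \<times> {-l..l} \<Longrightarrow>
      dist p' p < \<delta> \<Longrightarrow> dist (case p' of (x, t) \<Rightarrow> D x t) (case p of (x, t) \<Rightarrow> D x t) < m"
    using \<open>m > 0\<close> unfolding uniformly_continuous_on_def by metis
  have sep: "b - a \<ge> \<delta>" if ab: "x \<in> {0..1}" "a < b" "Z x a" "Z x b" for x a b
  proof (rule ccontr)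
    assume "\<not> b - a \<ge> \<delta>"
    \<comment> \<open>\<open>D x\<close> falls from at least \<open>m\<close> at \<open>a\<close> to
      \<open>0\<close> at \<open>\<xi>\<close>, which is impossible over a distance below
      \<open>\<delta>\<close>.\<close>
    obtain \<xi> where "a < \<xi>" "\<xi> < b" "D x \<xi> = 0" using two_zeros[OF ab] by blast
    moreover have "dist (x, \<xi>) (x, a) < \<delta>"
      using \<open>\<not> b - a \<ge> \<delta>\<close> \<open>a < \<xi>\<close> \<open>\<xi> < b\<close> by (simp add: dist_Pair_Pair dist_real_def)
    ultimately show False using \<delta>[of "(x, a)" "(x, \<xi>)"] ab by (auto simp: Z_def dist_real_def)
  qed
  have "compact S"
  proof -
    define T where "T = {0..1::real} \<times> {-l..l} \<times> {-l..l}"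
    have T: "continuous_on T (\<lambda>z. f (fst z) (fst (snd z)))" "continuous_on T (\<lambda>z. f (fst z) (snd (snd z)))"
      if "continuous_on ({0..1} \<times> {-l..l}) (\<lambda>(x, t). f x t)" for f :: "real \<Rightarrow> real \<Rightarrow> real"
    proof -
      have "continuous_on T ((\<lambda>(x, t). f x t) \<circ> (\<lambda>z. (fst z, fst (snd z))))"
        "continuous_on T ((\<lambda>(x, t). f x t) \<circ> (\<lambda>z. (fst z, snd (snd z))))"
        by (intro continuous_on_compose continuous_intros continuous_on_subset[OF that];
            force simp: T_def)+
      then show "continuous_on T (\<lambda>z. f (fst z) (fst (snd z)))"
        "continuous_on T (\<lambda>z. f (fst z) (snd (snd z)))"
        by (simp_all add: o_def)
    qed
    have "compact T" unfolding T_def by (intro compact_Times) auto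
    \<comment> \<open>By \<open>sep\<close> the open condition \<open>a < b\<close> sharpens to a
      gap of at least \<open>\<delta>\<close>. All conditions on \<open>(x, a, b)\<close> are then
      closed, and \<open>S\<close> is the projection of a compact set.\<close>
    define P where "P = {z \<in> T. \<psi> (fst z) (fst (snd z)) = 0} \<inter> {z \<in> T. \<psi> (fst z) (snd (snd z)) = 0} \<inter>
      {z \<in> T. m \<le> D (fst z) (fst (snd z))} \<inter> {z \<in> T. m \<le> D (fst z) (snd (snd z))} \<inter>
      {z \<in> T. fst (snd z) + \<delta> \<le> snd (snd z)}"
    have "closed T" by (rule compact_imp_closed) fact
    have "closed P" unfolding P_def
      by (intro closed_Int continuous_closed_preimage_constant continuous_on_closed_Collect_le
          continuous_intros T cont \<open>closed T\<close>)
    then have "compact (T \<inter> P)" using \<open>compact T\<close> by (simp add: compact_Int_closed)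
    then have "compact (fst ` (T \<inter> P))" by (intro compact_continuous_image continuous_intros)
    moreover have "S = fst ` (T \<inter> P)"
    proof
      show "S \<subseteq> fst ` (T \<inter> P)"
      proof
        fix x assume "x \<in> S"
        then obtain a b where "x \<in> {0..1}" "a < b" "Z x a" "Z x b" by (auto simp: S_def)
        then have "(x, a, b) \<in> T \<inter> P" using sep[of x a b] by (auto simp: Z_def P_def T_def)
        then show "x \<in> fst ` (T \<inter> P)" by force
      qed
      show "fst ` (T \<inter> P) \<subseteq> S"
      proof
        fix x assume "x \<in> fst ` (T \<inter> P)"
        then obtain a b where "(x, a, b) \<in> T \<inter> P" by force
        then have "x \<in> {0..1}" "a < b" "Z x a" "Z x b"
          using \<open>\<delta> > 0\<close> by (auto simp: T_def P_def Z_def)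
        then show "x \<in> S" by (auto simp: S_def)
      qed
    qed
    ultimately show ?thesis by simp
  qed
  \<comment> \<open>\<open>\<psi> 1\<close> has the signs -, +, -, + at \<open>-l\<close>,
    \<open>a1\<close>, \<open>b1\<close>, \<open>l\<close>, so there is one minimizer left of
    \<open>a1\<close> and another right of \<open>b1\<close>.\<close>
  moreover have "1 \<in> S"
  proof -
    obtain a where "a < a1" "Z 1 a" using Z_between[of 1 "-l" a1] ends[of 1] bistable by auto
    moreover obtain b where "b1 < b" "Z 1 b" using Z_between[of 1 b1 l] ends[of 1] bistable by auto
    ultimately have "a < b" "Z 1 a" "Z 1 b" using bistable by auto
    then show ?thesis unfolding S_def by auto
  qed
  ultimately obtain x0 where "x0 \<in> S" and least: "\<And>x. x \<in> S \<Longrightarrow> x0 \<le> x"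
    using compact_attains_inf[of S] by blast
  then obtain a b where x0: "x0 \<in> {0..1}" and ab: "a < b" "Z x0 a" "Z x0 b" by (auto simp: S_def)
  have "x0 \<noteq> 0"
  proof
    assume "x0 = 0"
    then obtain \<xi> where "a < \<xi>" "\<xi> < b" "D 0 \<xi> = 0" using two_zeros[OF x0 ab] by blast
    then show False using convex[of \<xi>] ab by (auto simp: Z_def)
  qed
  have inner: "-l < t \<and> t < l" if "Z x0 t" for t
    using that ends[OF x0] by (cases "t = l"; cases "t = -l") (auto simp: Z_def)
  \<comment> \<open>The signs of \<open>\<psi> x0\<close> on both sides of \<open>t\<close> persist
    for \<open>x\<close> near \<open>x0\<close>, and \<open>Z_between\<close> turns them into a zero
    for \<open>x\<close>. Shrinking \<open>e\<close> to \<open>e'\<close> keeps the window inside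
    \<open>[-l, l]\<close>.\<close>
  have persist: "\<exists>u v. t - e < u \<and> u < v \<and> v < t + e \<and> (\<forall>\<^sub>F x in at x0 within {0..1}. \<exists>\<tau>. u < \<tau> \<and> \<tau> < v \<and> Z x \<tau>)"
    if "Z x0 t" "e > 0" for t e
  proof -
    define e' where "e' = min e (min (t + l) (l - t))"
    have "e' > 0" using inner[OF that(1)] that(2) by (auto simp: e'_def)
    have "(\<psi> x0 has_real_derivative D x0 t) (at t)" "D x0 t > 0" "\<psi> x0 t = 0"
      using that \<open>m > 0\<close> x0 by (auto simp: Z_def intro!: \<psi>)
    then obtain u v where uv: "t - e' < u" "u < t" "t < v" "v < t + e'" "\<psi> x0 u < 0" "\<psi> x0 v > 0"
      using sign_change_at_simple_zero \<open>e' > 0\<close> by metis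
    have range: "-l \<le> u" "u < v" "v \<le> l" "t - e < u" "v < t + e"
      using uv by (auto simp: e'_def)
    have lim: "((\<lambda>x. \<psi> x w) \<longlongrightarrow> \<psi> x0 w) (at x0 within {0..1})" if "w \<in> {-l..l}" for w
    proof -
      have "continuous_on {0..1} ((\<lambda>(x, t). \<psi> x t) \<circ> (\<lambda>x. (x, w)))"
        using that by (intro continuous_on_compose continuous_intros continuous_on_subset[OF cont(1)]) auto
      then show ?thesis using x0 by (auto simp: continuous_on_def)
    qed
    have "\<forall>\<^sub>F x in at x0 within {0..1}. \<psi> x u < 0" "\<forall>\<^sub>F x in at x0 within {0..1}. \<psi> x v > 0"
      using lim[of u] lim[of v] uv range by (auto intro: order_tendstoD)
    moreover have "\<forall>\<^sub>F x in at x0 within {0..1}. x \<in> {0..1}"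
      by (simp add: eventually_at_filter)
    ultimately have "\<forall>\<^sub>F x in at x0 within {0..1}. \<exists>\<tau>. u < \<tau> \<and> \<tau> < v \<and> Z x \<tau>"
      by eventually_elim (use range in \<open>auto intro!: Z_between\<close>)
    then show ?thesis using range by blast
  qed
  \<comment> \<open>Half the gap makes the windows around \<open>a\<close> and \<open>b\<close>
    disjoint, so the two continued zeros stay distinct.\<close>
  define e where "e = (b - a) / 2"
  have "e > 0" using ab by (simp add: e_def)
  obtain u v u' v' where uv: "v < a + e" "b - e < u'"
    and ev: "\<forall>\<^sub>F x in at x0 within {0..1}. \<exists>\<tau>. u < \<tau> \<and> \<tau> < v \<and> Z x \<tau>"
      "\<forall>\<^sub>F x in at x0 within {0..1}. \<exists>\<tau>. u' < \<tau> \<and> \<tau> < v' \<and> Z x \<tau>"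
    using persist[OF ab(2) \<open>e > 0\<close>] persist[OF ab(3) \<open>e > 0\<close>] by blast
  have "v < u'" using uv by (simp add: e_def field_simps)
  have "\<forall>\<^sub>F x in at x0 within {0..1}. \<exists>a b. a < b \<and> Z x a \<and> Z x b"
    using ev
  proof eventually_elim
    case (elim x)
    then obtain \<tau> \<tau>' where "\<tau> < v" "u' < \<tau>'" "Z x \<tau>" "Z x \<tau>'" by blast
    then show ?case using \<open>v < u'\<close> by (intro exI[of _ \<tau>] exI[of _ \<tau>']) auto
  qed
  then obtain d where "d > 0" and d: "\<And>x. x \<in> {0..1} \<Longrightarrow> x \<noteq> x0 \<Longrightarrow> dist x x0 < d \<Longrightarrow>
      \<exists>a b. a < b \<and> Z x a \<and> Z x b"
    unfolding eventually_at by auto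
  \<comment> \<open>The maximum keeps \<open>x\<close> in \<open>[0, 1]\<close>; since
    \<open>x0 > 0\<close>, it is still strictly below \<open>x0\<close>.\<close>
  define x where "x = max 0 (x0 - d / 2)"
  have "x < x0" "x \<in> {0..1}" "dist x x0 < d"
    using x0 \<open>x0 \<noteq> 0\<close> \<open>d > 0\<close> by (auto simp: x_def dist_real_def)
  then have "x \<in> S" using d[of x] by (auto simp: S_def)
  then show False using least[of x] \<open>x < x0\<close> by simp
qed

section \<open>Gradients and Hessians of parametric \<open>C\<^sup>2\<close> functions\<close>

lemma GDERIV_unique: "GDERIV f y :> D \<Longrightarrow> GDERIV f y :> D' \<Longrightarrow> D = D'"
  unfolding gderiv_def by (metis has_derivative_unique vector_eq_rdot inner_commute)

lemma grad_eq: "GDERIV f y :> D \<Longrightarrow> grad f y = D"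
  unfolding grad_def by (rule the_equality) (auto intro: GDERIV_unique)

lemma hessian_eq:
  assumes "\<And>z. GDERIV f z :> p z" "(p has_derivative (\<lambda>d. H *v d)) (at y)"
  shows "hessian f y = H"
proof -
  have "grad f = p" using assms(1) by (auto intro: grad_eq)
  then show ?thesis
    unfolding hessian_def jacobian_def using frechet_derivative_at[OF assms(2)]
    by (metis matrix_of_matrix_vector_mul)
qed

text \<open>Only derivatives in \<open>y\<close> are recorded, as two-sided derivatives with named
  gradient \<open>p\<close> and Hessian \<open>H\<close>, together with joint continuity in
  \<open>(x, y)\<close>. The one-sidedness at the ends of \<open>X\<close> thus disappears.\<close>

definition C2_family ::
  "real set \<Rightarrow> (real \<Rightarrow> real^'n \<Rightarrow> real) \<Rightarrow> (real \<Rightarrow> real^'n \<Rightarrow> real^'n) \<Rightarrow> (real \<Rightarrow> real^'n \<Rightarrow> real^'n^'n) \<Rightarrow> bool"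
  where "C2_family X f p H \<longleftrightarrow>
    (\<forall>x\<in>X. \<forall>y. GDERIV (f x) y :> p x y \<and> (p x has_derivative (\<lambda>d. H x y *v d)) (at y)) \<and>
    continuous_on (X \<times> UNIV) (\<lambda>(x, y). f x y) \<and>
    continuous_on (X \<times> UNIV) (\<lambda>(x, y). p x y) \<and>
    continuous_on (X \<times> UNIV) (\<lambda>(x, y). H x y)"

lemma C2_family_grad: "C2_family X f p H \<Longrightarrow> x \<in> X \<Longrightarrow> grad (f x) y = p x y"
  by (simp add: C2_family_def grad_eq)

lemma C2_family_hessian: "C2_family X f p H \<Longrightarrow> x \<in> X \<Longrightarrow> hessian (f x) y = H x y"
  by (auto simp: C2_family_def intro!: hessian_eq)

lemma has_derivative_matrix_add:
  assumes "(p has_derivative (\<lambda>d. A *v d)) F" "(q has_derivative (\<lambda>d. B *v d)) F"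
  shows "((\<lambda>z. p z + q z) has_derivative (\<lambda>d. (A + B) *v d)) F"
  using has_derivative_add[OF assms] by (simp add: matrix_vector_mult_add_rdistrib)

lemma C2_family_add:
  assumes "C2_family X f p A" "C2_family X g q B"
  shows "C2_family X (\<lambda>x y. f x y + g x y) (\<lambda>x y. p x y + q x y) (\<lambda>x y. A x y + B x y)"
  using assms unfolding C2_family_def
  by (auto simp: split_def intro!: GDERIV_add has_derivative_matrix_add continuous_intros)

lemma C2_on_imp_C2_family:
  fixes f :: "real \<Rightarrow> real^'n \<Rightarrow> real"
  assumes "C2_on (X \<times> UNIV) (\<lambda>(x, y). f x y)"
  obtains p H where "C2_family X f p H"
proof -
  obtain f' :: "real \<times> (real^'n) \<Rightarrow> (real \<times> (real^'n)) \<Rightarrow>\<^sub>L real"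
    and f'' :: "real \<times> (real^'n) \<Rightarrow> (real \<times> (real^'n)) \<Rightarrow>\<^sub>L (real \<times> (real^'n)) \<Rightarrow>\<^sub>L real"
    where f': "\<And>z. z \<in> X \<times> UNIV \<Longrightarrow>
        ((\<lambda>(x, y). f x y) has_derivative blinfun_apply (f' z)) (at z within X \<times> UNIV)"
      and f'': "\<And>z. z \<in> X \<times> UNIV \<Longrightarrow>
        (f' has_derivative blinfun_apply (f'' z)) (at z within X \<times> UNIV)"
      and cont: "continuous_on (X \<times> UNIV) f''"
    using assms unfolding C2_on_def by blast
  \<comment> \<open>The fibre over a fixed \<open>x\<close> is all of \<open>y\<close>-space and
    lies in \<open>X \<times> UNIV\<close>, so a derivative within that set restricts to an
    unrestricted derivative in \<open>y\<close>.\<close>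
  have slice: "((\<lambda>y. F (x, y)) has_derivative (\<lambda>d. L (0, d))) (at y)"
    if "x \<in> X" "(F has_derivative L) (at (x, y) within X \<times> UNIV)"
    for F :: "real \<times> (real^'n) \<Rightarrow> 'b::real_normed_vector" and L x y
  proof -
    have "((\<lambda>y. (x, y)) has_derivative (\<lambda>d. (0, d))) (at y)"
      by (auto intro!: derivative_eq_intros)
    moreover have "(F has_derivative L) (at (x, y) within range (\<lambda>y. (x, y)))"
      using that by (auto intro: has_derivative_subset)
    ultimately show ?thesis by (rule has_derivative_in_compose)
  qed
  have expand: "L (0, d) = (\<Sum>j\<in>UNIV. d $ j *\<^sub>R L (0, axis j 1))"
    if "linear L" for L :: "real \<times> (real^'n) \<Rightarrow> 'b::real_vector" and d
  proof -
    have "(0, d) = (\<Sum>j\<in>UNIV. d $ j *\<^sub>R (0::real, axis j (1::real)))"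
      by (simp add: prod_eq_iff fst_sum snd_sum basis_expansion scalar_mult_eq_scaleR[symmetric])
    then show ?thesis
      by (simp add: linear_sum[OF that] linear_scale[OF that] del: scaleR_Pair)
  qed
  define p where "p x y = (\<chi> j. f' (x, y) (0, axis j 1))" for x y
  \<comment> \<open>Row \<open>j\<close> is the gradient component, column \<open>k\<close> the
    direction in which it is differentiated. With this order \<open>H x y *v d\<close> is the
    derivative of \<open>p x\<close> without appeal to symmetry of second derivatives.\<close>
  define H where "H x y = (\<chi> j k. f'' (x, y) (0, axis k 1) (0, axis j 1))" for x y
  have "GDERIV (f x) y :> p x y" if "x \<in> X" for x y
  proof -
    have "blinfun_apply (f' (x, y)) (0, d) = d \<bullet> p x y" for d
      by (subst expand[OF bounded_linear.linear[OF blinfun.bounded_linear_right]]) (simp add: inner_vec_def p_def)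
    then show ?thesis
      using slice[OF that f', of y] that by (simp add: gderiv_def)
  qed
  moreover have "(p x has_derivative (\<lambda>d. H x y *v d)) (at y)" if "x \<in> X" for x y
  proof -
    have "((\<lambda>y. p x y $ j) has_derivative (\<lambda>d. (H x y *v d) $ j)) (at y)" for j
    proof -
      have "((\<lambda>y. f' (x, y) (0, axis j 1)) has_derivative (\<lambda>d. f'' (x, y) (0, d) (0, axis j 1))) (at y)"
        using bounded_linear.has_derivative[OF blinfun.bounded_linear_left slice[OF that f'', of y]] that by simp
      moreover have "f'' (x, y) (0, d) (0, axis j 1) = (H x y *v d) $ j" for d
        by (subst expand[OF bounded_linear.linear[OF blinfun.bounded_linear_right]])
          (simp add: H_def matrix_vector_mult_def blinfun.sum_left blinfun.scaleR_left mult.commute)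
      ultimately show ?thesis by (simp add: p_def)
    qed
    then show ?thesis
      by (subst has_derivative_componentwise_within) (auto simp: Basis_vec_def inner_axis)
  qed
  moreover have "continuous_on (X \<times> UNIV) (\<lambda>(x, y). f x y)"
    using f' by (rule has_derivative_continuous_on)
  moreover have "continuous_on (X \<times> UNIV) f'"
    using f'' by (rule has_derivative_continuous_on)
  then have "continuous_on (X \<times> UNIV) (\<lambda>(x, y). p x y)"
    unfolding p_def split_def by (simp, intro continuous_intros)
  moreover have "continuous_on (X \<times> UNIV) (\<lambda>(x, y). H x y)"
    using cont unfolding H_def split_def by (simp, intro continuous_intros)
  ultimately show ?thesis
    using that[of p H] by (auto simp: C2_family_def)
qed

section \<open>Elimination of the first variable along an active constraint\<close>

lemma GDERIV_along_curve:
  assumes "GDERIV f (c t) :> D" "(c has_vector_derivative v) (at t)"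
  shows "((\<lambda>t. f (c t)) has_real_derivative v \<bullet> D) (at t)"
proof -
  have "((\<lambda>t. f (c t)) has_derivative (\<lambda>k. (k *\<^sub>R v) \<bullet> D)) (at t)"
    using has_derivative_compose[OF assms(2)[unfolded has_vector_derivative_def] assms(1)[unfolded gderiv_def]] .
  then show ?thesis by (simp add: has_field_derivative_def mult_commute_abs)
qed

text \<open>Written through the basis vectors, so that continuity and derivatives follow from the
  rules for sums and scalings.\<close>

definition pt :: "real \<Rightarrow> real \<Rightarrow> real^2" where
  "pt a t = a *\<^sub>R axis 1 1 + t *\<^sub>R axis 2 1"

lemma pt_nth [simp]: "pt a t $ 1 = a" "pt a t $ 2 = t"
  by (simp_all add: pt_def axis_def)

lemma pt_eta [simp]: "pt (z $ 1) (z $ 2) = z"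
  by (simp add: vec_eq_iff forall_2)

lemma continuous_on_pt [continuous_intros]:
  "continuous_on S a \<Longrightarrow> continuous_on S t \<Longrightarrow> continuous_on S (\<lambda>z. pt (a z) (t z))"
  unfolding pt_def by (intro continuous_intros)

lemma has_vector_derivative_pt [derivative_intros]:
  assumes "(a has_real_derivative a') (at t)" "(b has_real_derivative b') (at t)"
  shows "((\<lambda>t. pt (a t) (b t)) has_vector_derivative pt a' b') (at t)"
  using has_vector_derivative_add[OF
      has_vector_derivative_scaleR[OF assms(1) has_vector_derivative_const]
      has_vector_derivative_scaleR[OF assms(2) has_vector_derivative_const]]
  by (simp add: pt_def)

lemma inner_real2: "(v :: real^2) \<bullet> w = v $ 1 * w $ 1 + v $ 2 * w $ 2"
  by (simp add: inner_vec_def sum_2)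

lemma continuous_on_matrix_vector_mult [continuous_intros]:
  fixes A :: "'a::topological_space \<Rightarrow> real^'n^'m"
  assumes "continuous_on S A" "continuous_on S v"
  shows "continuous_on S (\<lambda>z. A z *v v z)"
  unfolding matrix_vector_mult_def by (intro continuous_intros assms)

text \<open>\<open>g\<close> and \<open>h\<close> stand for the perturbed objective and first
  constraint, with gradients \<open>p\<close>, \<open>q\<close> and Hessians \<open>A\<close>,
  \<open>B\<close>. The strip of half-width \<open>1/2\<close> surrounds the unperturbed edge
  \<open>y $ 1 = 0\<close>; \<open>gradients\<close> and \<open>edges\<close> hold the quantitative
  facts from which the first variable is eliminated.\<close>

locale reduced_problem =
  fixes g h :: "real \<Rightarrow> real^2 \<Rightarrow> real"
    and p q :: "real \<Rightarrow> real^2 \<Rightarrow> real^2" and A B :: "real \<Rightarrow> real^2 \<Rightarrow> real^2^2"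
  assumes g: "C2_family {0..1} g p A" and h: "C2_family {0..1} h q B"
    and gradients: "\<And>x a t. x \<in> {0..1} \<Longrightarrow> a \<in> {-1/2..1/2} \<Longrightarrow> t \<in> {-6..6} \<Longrightarrow>
      p x (pt a t) $ 1 > 0 \<and> q x (pt a t) $ 1 < 0"
    and edges: "\<And>x t. x \<in> {0..1} \<Longrightarrow> t \<in> {-6..6} \<Longrightarrow> h x (pt (-1/2) t) > 0 \<and> h x (pt (1/2) t) < 0"
begin

lemma GDERIV_g: "x \<in> {0..1} \<Longrightarrow> GDERIV (g x) y :> p x y"
  and GDERIV_h: "x \<in> {0..1} \<Longrightarrow> GDERIV (h x) y :> q x y"
  and deriv_p: "x \<in> {0..1} \<Longrightarrow> (p x has_derivative (\<lambda>d. A x y *v d)) (at y)"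
  and deriv_q: "x \<in> {0..1} \<Longrightarrow> (q x has_derivative (\<lambda>d. B x y *v d)) (at y)"
  using g h by (auto simp: C2_family_def)

lemma deriv_horizontal:
  assumes "GDERIV f (pt a t) :> D"
  shows "((\<lambda>a. f (pt a t)) has_real_derivative D $ 1) (at a)"
proof -
  have "((\<lambda>a. pt a t) has_vector_derivative pt 1 0) (at a)"
    by (intro has_vector_derivative_pt DERIV_ident DERIV_const)
  from GDERIV_along_curve[OF assms this] show ?thesis by (simp add: inner_real2)
qed

section \<open>The active constraint as a graph over the second coordinate\<close>

lemma h_decreasing:
  assumes "x \<in> {0..1}" "t \<in> {-6..6}" "-1/2 \<le> a" "a < b" "b \<le> 1/2"
  shows "h x (pt b t) < h x (pt a t)"
proof (rule DERIV_neg_imp_decreasing[OF \<open>a < b\<close>])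
  fix c assume "a \<le> c" "c \<le> b"
  then show "\<exists>y. ((\<lambda>a. h x (pt a t)) has_real_derivative y) (at c) \<and> y < 0"
    using assms gradients[of x c t] deriv_horizontal[OF GDERIV_h] by auto
qed

lemma g_increasing:
  assumes "x \<in> {0..1}" "t \<in> {-6..6}" "-1/2 \<le> a" "a < b" "b \<le> 1/2"
  shows "g x (pt a t) < g x (pt b t)"
proof (rule DERIV_pos_imp_increasing[OF \<open>a < b\<close>])
  fix c assume "a \<le> c" "c \<le> b"
  then show "\<exists>y. ((\<lambda>a. g x (pt a t)) has_real_derivative y) (at c) \<and> y > 0"
    using assms gradients[of x c t] deriv_horizontal[OF GDERIV_g] by auto
qed

lemma ex1_root:
  assumes "x \<in> {0..1}" "t \<in> {-6..6}"
  shows "\<exists>!a. a \<in> {-1/2..1/2} \<and> h x (pt a t) = 0"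
proof -
  have "continuous_on {-1/2..1/2} (\<lambda>a. h x (pt a t))"
    using deriv_horizontal[OF GDERIV_h[OF assms(1)]] by (meson DERIV_isCont continuous_at_imp_continuous_on)
  then obtain a where "a \<in> {-1/2..1/2}" "h x (pt a t) = 0"
    using IVT2'[of "\<lambda>a. h x (pt a t)" "1/2" 0 "-1/2"] edges[OF assms] by (auto simp: less_imp_le)
  moreover have "b = c" if "b \<in> {-1/2..1/2}" "h x (pt b t) = 0" "c \<in> {-1/2..1/2}" "h x (pt c t) = 0" for b c
    using h_decreasing[OF assms, of b c] h_decreasing[OF assms, of c b] that
    by (cases b c rule: linorder_cases) auto
  ultimately show ?thesis by blast
qed

definition \<phi> :: "real \<Rightarrow> real \<Rightarrow> real" where
  "\<phi> x t = (THE a. a \<in> {-1/2..1/2} \<and> h x (pt a t) = 0)"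

lemma \<phi>_unique:
  "x \<in> {0..1} \<Longrightarrow> t \<in> {-6..6} \<Longrightarrow> a \<in> {-1/2..1/2} \<Longrightarrow> h x (pt a t) = 0 \<Longrightarrow> \<phi> x t = a"
  unfolding \<phi>_def using ex1_root[of x t] by (intro the1_equality) auto

lemma \<phi>:
  assumes "x \<in> {0..1}" "t \<in> {-6..6}"
  shows "\<phi> x t \<in> {-1/2<..<1/2}" "h x (pt (\<phi> x t) t) = 0"
proof -
  have "\<phi> x t \<in> {-1/2..1/2} \<and> h x (pt (\<phi> x t) t) = 0"
    using theI'[OF ex1_root[OF assms]] unfolding \<phi>_def .
  moreover from this edges[OF assms] have "\<phi> x t \<noteq> -1/2" "\<phi> x t \<noteq> 1/2"
    by (metis less_irrefl)+
  ultimately show "\<phi> x t \<in> {-1/2<..<1/2}" "h x (pt (\<phi> x t) t) = 0" by auto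
qed

lemma feasible_imp_ge_\<phi>:
  assumes "x \<in> {0..1}" "t \<in> {-6..6}" "a \<in> {-1/2..1/2}" "h x (pt a t) \<le> 0"
  shows "\<phi> x t \<le> a"
proof (rule ccontr)
  assume "\<not> \<phi> x t \<le> a"
  then have "h x (pt (\<phi> x t) t) < h x (pt a t)"
    using \<phi>(1)[OF assms(1,2)] assms by (intro h_decreasing) auto
  then show False using \<phi>(2)[OF assms(1,2)] assms(4) by simp
qed

lemma continuous_on_family:
  assumes "continuous_on ({0..1} \<times> UNIV) (\<lambda>(x, y). F x y)"
    and "continuous_on S a" "continuous_on S b" "a ` S \<subseteq> {0..1}"
  shows "continuous_on S (\<lambda>z. F (a z) (b z))"
proof -
  have "continuous_on S ((\<lambda>(x, y). F x y) \<circ> (\<lambda>z. (a z, b z)))"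
    using assms by (intro continuous_on_compose continuous_intros continuous_on_subset[OF assms(1)]) auto
  then show ?thesis by (simp add: o_def)
qed

text \<open>A map into a compact set is continuous if its graph is closed; by uniqueness of the root
  the graph is the zero set of \<open>h\<close> over the strip. This gives continuity jointly in
  \<open>x\<close> and \<open>t\<close>, up to the boundary.\<close>

lemma continuous_\<phi>: "continuous_on ({0..1} \<times> {-6..6}) (\<lambda>z. \<phi> (fst z) (snd z))"
proof (rule continuous_from_closed_graph[of "{-1/2..1/2}"])
  show "(\<lambda>z. \<phi> (fst z) (snd z)) \<in> {0..1} \<times> {-6..6} \<rightarrow> {-1/2..1/2}"
  proof
    fix z :: "real \<times> real" assume "z \<in> {0..1} \<times> {-6..6}"
    then show "\<phi> (fst z) (snd z) \<in> {-1/2..1/2}"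
      using \<phi>(1)[of "fst z" "snd z"] by (auto simp: mem_Times_iff)
  qed
  define T where "T = ({0..1::real} \<times> {-6..6::real}) \<times> {-1/2..1/2::real}"
  have "continuous_on T (\<lambda>z. h (fst (fst z)) (pt (snd z) (snd (fst z))))"
    using h by (intro continuous_on_family[of h] continuous_intros) (auto simp: C2_family_def T_def)
  then have "closed {z \<in> T. h (fst (fst z)) (pt (snd z) (snd (fst z))) = 0}"
    by (rule continuous_closed_preimage_constant) (auto simp: T_def intro: closed_Times)
  also have "{z \<in> T. h (fst (fst z)) (pt (snd z) (snd (fst z))) = 0} =
      (\<lambda>z. (z, \<phi> (fst z) (snd z))) ` ({0..1} \<times> {-6..6})"
  proof (intro equalityI subsetI)
    fix z assume "z \<in> {z \<in> T. h (fst (fst z)) (pt (snd z) (snd (fst z))) = 0}"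
    then obtain x t a where "z = ((x, t), a)" "x \<in> {0..1}" "t \<in> {-6..6}" "a \<in> {-1/2..1/2}" "h x (pt a t) = 0"
      unfolding T_def by auto
    moreover from this have "\<phi> x t = a" by (intro \<phi>_unique)
    ultimately show "z \<in> (\<lambda>z. (z, \<phi> (fst z) (snd z))) ` ({0..1} \<times> {-6..6})"
      by auto
  next
    fix z assume "z \<in> (\<lambda>z. (z, \<phi> (fst z) (snd z))) ` ({0..1} \<times> {-6..6})"
    then obtain x t where "z = ((x, t), \<phi> x t)" "x \<in> {0..1}" "t \<in> {-6..6}" by auto
    then show "z \<in> {z \<in> T. h (fst (fst z)) (pt (snd z) (snd (fst z))) = 0}"
      using \<phi>[of x t] by (auto simp: T_def)
  qed
  finally show "closed ((\<lambda>z. (z, \<phi> (fst z) (snd z))) ` ({0..1} \<times> {-6..6}))" .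
qed auto

section \<open>The reduced objective along the graph and its derivatives\<close>

definition Y :: "real \<Rightarrow> real \<Rightarrow> real^2" where
  "Y x t = pt (\<phi> x t) t"

lemma Y_nth [simp]: "Y x t $ 1 = \<phi> x t" "Y x t $ 2 = t"
  by (simp_all add: Y_def)

lemma gradients_Y:
  "x \<in> {0..1} \<Longrightarrow> t \<in> {-6..6} \<Longrightarrow> p x (Y x t) $ 1 > 0 \<and> q x (Y x t) $ 1 < 0"
  unfolding Y_def using \<phi>(1)[of x t] by (intro gradients) auto

text \<open>The velocity of the curve \<open>Y x\<close>: its first entry is the slope of
  \<open>\<phi> x\<close> by implicit differentiation.\<close>

definition d :: "real \<Rightarrow> real \<Rightarrow> real^2" where
  "d x t = pt (- q x (Y x t) $ 2 / q x (Y x t) $ 1) 1"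

text \<open>The Lagrange multiplier of the active constraint, solved from the first coordinate of
  the stationarity equation; it is defined at every \<open>t\<close>, stationary or not.\<close>

definition \<Lambda> :: "real \<Rightarrow> real \<Rightarrow> real" where
  "\<Lambda> x t = - p x (Y x t) $ 1 / q x (Y x t) $ 1"

definition G :: "real \<Rightarrow> real \<Rightarrow> real" where
  "G x t = g x (Y x t)"

definition \<psi> :: "real \<Rightarrow> real \<Rightarrow> real" where
  "\<psi> x t = d x t \<bullet> p x (Y x t)"

text \<open>The quadratic form of the Lagrangian Hessian on the tangent \<open>d x t\<close>;
  \<open>deriv_\<psi>\<close> identifies it with the second derivative of
  \<open>G x\<close>.\<close>

definition D :: "real \<Rightarrow> real \<Rightarrow> real" where
  "D x t = d x t \<bullet> ((A x (Y x t) + \<Lambda> x t *\<^sub>R B x (Y x t)) *v d x t)"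

lemma continuous_Y: "continuous_on ({0..1} \<times> {-6..6}) (\<lambda>z. Y (fst z) (snd z))"
  unfolding Y_def by (intro continuous_intros continuous_\<phi>)

lemma continuous_family_Y:
  assumes "continuous_on ({0..1} \<times> UNIV) (\<lambda>(x, y). F x y)"
  shows "continuous_on ({0..1} \<times> {-6..6}) (\<lambda>z. F (fst z) (Y (fst z) (snd z)))"
  by (intro continuous_on_family[OF assms] continuous_Y continuous_intros) auto

lemma continuous_reduced:
  "continuous_on ({0..1} \<times> {-6..6}) (\<lambda>(x, t). \<psi> x t)"
  "continuous_on ({0..1} \<times> {-6..6}) (\<lambda>(x, t). D x t)"
proof -
  have nz: "\<forall>z\<in>{0..1} \<times> {-6..6}. q (fst z) (Y (fst z) (snd z)) $ 1 \<noteq> 0"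
    using gradients_Y by force
  have [continuous_intros]:
    "continuous_on ({0..1} \<times> {-6..6}) (\<lambda>z. p (fst z) (Y (fst z) (snd z)))"
    "continuous_on ({0..1} \<times> {-6..6}) (\<lambda>z. q (fst z) (Y (fst z) (snd z)))"
    "continuous_on ({0..1} \<times> {-6..6}) (\<lambda>z. A (fst z) (Y (fst z) (snd z)))"
    "continuous_on ({0..1} \<times> {-6..6}) (\<lambda>z. B (fst z) (Y (fst z) (snd z)))"
    using g h by (auto simp: C2_family_def intro: continuous_family_Y[of p] continuous_family_Y[of q]
        continuous_family_Y[of A] continuous_family_Y[of B])
  show "continuous_on ({0..1} \<times> {-6..6}) (\<lambda>(x, t). \<psi> x t)"
    unfolding split_def \<psi>_def d_def by (intro continuous_intros nz)
  show "continuous_on ({0..1} \<times> {-6..6}) (\<lambda>(x, t). D x t)"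
    unfolding split_def D_def \<Lambda>_def d_def by (intro continuous_intros nz)
qed

text \<open>Implicit differentiation by the mean value theorem: \<open>h x\<close> vanishes at both
  ends of the chord from \<open>Y x t\<close> to \<open>Y x (t + k)\<close>, so the difference
  quotient of \<open>\<phi> x\<close> equals \<open>- q $ 2 / q $ 1\<close> at some point of the
  chord. That point tends to \<open>Y x t\<close> as \<open>k\<close> tends to
  \<open>0\<close>.\<close>

lemma deriv_\<phi>:
  assumes x: "x \<in> {0..1}" and t: "t \<in> {-6<..<6}"
  shows "(\<phi> x has_real_derivative - q x (Y x t) $ 2 / q x (Y x t) $ 1) (at t)"
proof -
  have "continuous_on {-6<..<6} (\<lambda>s. (\<lambda>z. Y (fst z) (snd z)) (x, s))"
    by (rule continuous_on_compose2[OF continuous_Y]) (use x in \<open>auto intro!: continuous_intros\<close>)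
  then have "isCont (Y x) t"
    using t by (simp add: continuous_on_eq_continuous_at)
  then have "(\<lambda>k. Y x (t + k)) \<midarrow>0\<rightarrow> Y x t"
    by (simp add: isCont_iff)
  then have lim_norm: "((\<lambda>k. norm (Y x (t + k) - Y x t)) \<longlongrightarrow> 0) (at 0)"
    by (simp add: LIM_zero tendsto_norm_zero)
  have ex: "\<exists>\<xi>. norm (\<xi> - Y x t) \<le> norm (Y x (t + k) - Y x t) \<and>
      (\<phi> x (t + k) - \<phi> x t) / k = - q x \<xi> $ 2 / q x \<xi> $ 1"
    if "t + k \<in> {-6..6}" "k \<noteq> 0" for k
  proof -
    define v where "v = Y x (t + k) - Y x t"
    have v: "v $ 1 = \<phi> x (t + k) - \<phi> x t" "v $ 2 = k"
      by (auto simp: v_def)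
    define \<gamma> where "\<gamma> \<tau> = Y x t + \<tau> *\<^sub>R v" for \<tau>
    have "((\<lambda>\<tau>. h x (\<gamma> \<tau>)) has_real_derivative v \<bullet> q x (\<gamma> \<tau>)) (at \<tau>)" for \<tau>
    proof (rule GDERIV_along_curve[OF GDERIV_h[OF x]])
      show "(\<gamma> has_vector_derivative v) (at \<tau>)"
        unfolding \<gamma>_def by (auto intro!: derivative_eq_intros)
    qed
    then obtain \<tau> where \<tau>: "0 < \<tau>" "\<tau> < 1" "h x (\<gamma> 1) - h x (\<gamma> 0) = (1 - 0) * (v \<bullet> q x (\<gamma> \<tau>))"
      using MVT2[of 0 1 "\<lambda>\<tau>. h x (\<gamma> \<tau>)" "\<lambda>\<tau>. v \<bullet> q x (\<gamma> \<tau>)"] by auto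
    have "h x (\<gamma> 1) = 0" "h x (\<gamma> 0) = 0"
      using \<phi>(2)[of x "t + k"] \<phi>(2)[of x t] x t that by (auto simp: \<gamma>_def v_def Y_def)
    then have eq: "v $ 1 * q x (\<gamma> \<tau>) $ 1 + k * q x (\<gamma> \<tau>) $ 2 = 0"
      using \<tau>(3) by (simp add: inner_real2 v)
    have "norm (\<gamma> \<tau> - Y x t) \<le> norm v"
      using \<tau> by (simp add: \<gamma>_def mult_left_le_one_le)
    moreover have "q x (\<gamma> \<tau>) $ 1 < 0"
    proof -
      \<comment> \<open>The strip is convex, so the intermediate point stays where
        \<open>q x\<close> has a negative first entry and the division is legitimate.\<close>
      have conv: "(1 - \<tau>) * a + \<tau> * b \<in> {l..u}" if "a \<in> {l..u}" "b \<in> {l..u}" for a b l u :: real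
        using convexD_alt[of "{l..u}" a b \<tau>] that \<tau> by simp
      have "(1 - \<tau>) * \<phi> x t + \<tau> * \<phi> x (t + k) \<in> {-1/2..1/2}" "(1 - \<tau>) * t + \<tau> * (t + k) \<in> {-6..6}"
        using \<phi>(1)[of x "t + k"] \<phi>(1)[of x t] x t that by (intro conv; force)+
      moreover have "\<gamma> \<tau> = pt ((1 - \<tau>) * \<phi> x t + \<tau> * \<phi> x (t + k)) ((1 - \<tau>) * t + \<tau> * (t + k))"
        by (simp add: vec_eq_iff forall_2 \<gamma>_def v algebra_simps)
      ultimately show ?thesis using gradients[OF x] by metis
    qed
    ultimately show ?thesis
      using eq that(2) v by (intro exI[of _ "\<gamma> \<tau>"]) (auto simp: v_def field_simps add_eq_0_iff)
  qed
  then obtain \<xi> where \<xi>: "\<And>k. t + k \<in> {-6..6} \<Longrightarrow> k \<noteq> 0 \<Longrightarrow> norm (\<xi> k - Y x t) \<le> norm (Y x (t + k) - Y x t)"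
    "\<And>k. t + k \<in> {-6..6} \<Longrightarrow> k \<noteq> 0 \<Longrightarrow> (\<phi> x (t + k) - \<phi> x t) / k = - q x (\<xi> k) $ 2 / q x (\<xi> k) $ 1"
    by metis
  have near: "\<forall>\<^sub>F k in at 0. t + k \<in> {-6..6} \<and> k \<noteq> 0"
    unfolding eventually_at using t
    by (intro exI[of _ "min (6 - t) (6 + t)"]) (auto simp: dist_real_def)
  have "((\<lambda>k. \<xi> k - Y x t) \<longlongrightarrow> 0) (at 0)"
    by (rule Lim_null_comparison[OF _ lim_norm]) (use near \<xi>(1) in \<open>auto elim: eventually_mono\<close>)
  then have "(\<xi> \<longlongrightarrow> Y x t) (at 0)" by (simp add: LIM_zero_iff)
  moreover have "isCont (q x) (Y x t)"
    using deriv_q[OF x] has_derivative_continuous by blast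
  ultimately have "((\<lambda>k. q x (\<xi> k)) \<longlongrightarrow> q x (Y x t)) (at 0)"
    by (rule isCont_tendsto_compose[rotated])
  then have "((\<lambda>k. - q x (\<xi> k) $ 2 / q x (\<xi> k) $ 1) \<longlongrightarrow> - q x (Y x t) $ 2 / q x (Y x t) $ 1) (at 0)"
    using gradients_Y[of x t] x t by (intro tendsto_intros) auto
  moreover have "\<forall>\<^sub>F k in at 0. - q x (\<xi> k) $ 2 / q x (\<xi> k) $ 1 = (\<phi> x (t + k) - \<phi> x t) / k"
    using near by eventually_elim (simp add: \<xi>(2))
  ultimately show ?thesis
    unfolding DERIV_def by (rule Lim_transform_eventually)
qed

lemma deriv_Y:
  assumes "x \<in> {0..1}" "t \<in> {-6<..<6}"
  shows "(Y x has_vector_derivative d x t) (at t)"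
  unfolding Y_def[abs_def] d_def
  using has_vector_derivative_pt[OF deriv_\<phi>[OF assms] DERIV_ident] by (simp add: Y_def)

lemma deriv_G:
  assumes "x \<in> {0..1}" "t \<in> {-6<..<6}"
  shows "(G x has_real_derivative \<psi> x t) (at t)"
  unfolding G_def[abs_def] \<psi>_def
  by (rule GDERIV_along_curve[OF GDERIV_g deriv_Y]) (use assms in auto)

lemma deriv_along_Y:
  assumes "x \<in> {0..1}" "t \<in> {-6<..<6}" "(F has_derivative (\<lambda>v. M *v v)) (at (Y x t))"
  shows "((\<lambda>t. F (Y x t) $ i) has_real_derivative (M *v d x t) $ i) (at t)"
proof -
  have "((\<lambda>t. F (Y x t)) has_derivative (\<lambda>k. M *v (k *\<^sub>R d x t))) (at t)"
    using has_derivative_compose[OF deriv_Y[OF assms(1,2), unfolded has_vector_derivative_def] assms(3)] .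
  then have "((\<lambda>t. F (Y x t) $ i) has_derivative (\<lambda>k. (M *v (k *\<^sub>R d x t)) $ i)) (at t)"
    by (rule bounded_linear.has_derivative[OF bounded_linear_vec_nth])
  then show ?thesis
    by (simp add: has_field_derivative_def matrix_vector_mult_scaleR mult_commute_abs)
qed

text \<open>Differentiating \<open>p\<close> along the curve gives the \<open>A\<close> part of
  \<open>D\<close>. Differentiating the slope \<open>- q $ 2 / q $ 1\<close> gives the curvature of
  the curve; multiplied by \<open>p $ 1\<close> it is exactly
  \<open>\<Lambda> x t * (d x t \<bullet> w)\<close>, the \<open>B\<close> part.\<close>

lemma deriv_\<psi>:
  assumes x: "x \<in> {0..1}" and t: "t \<in> {-6<..<6}"
  shows "(\<psi> x has_real_derivative D x t) (at t)"
proof -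
  define u where "u = A x (Y x t) *v d x t"
  define w where "w = B x (Y x t) *v d x t"
  define p1 q1 q2 where "p1 = p x (Y x t) $ 1" "q1 = q x (Y x t) $ 1" "q2 = q x (Y x t) $ 2"
  note dp = deriv_along_Y[OF x t deriv_p[OF x], folded u_def]
  note dq = deriv_along_Y[OF x t deriv_q[OF x], folded w_def]
  have "q1 < 0" using gradients_Y[of x t] x t by (simp add: p1_q1_q2_def)
  have "((\<lambda>t. - q x (Y x t) $ 2 / q x (Y x t) $ 1 * p x (Y x t) $ 1 + p x (Y x t) $ 2) has_real_derivative
      ((- w $ 2) * q1 - (- q2) * w $ 1) / (q1 * q1) * p1 + u $ 1 * (- q2 / q1) + u $ 2) (at t)"
    using \<open>q1 < 0\<close> unfolding p1_q1_q2_def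
    by (intro DERIV_add DERIV_mult DERIV_divide DERIV_minus dp dq) auto
  moreover have "D x t = d x t \<bullet> u + \<Lambda> x t * (d x t \<bullet> w)"
    by (simp add: D_def matrix_vector_mult_add_rdistrib scaleR_matrix_vector_assoc[symmetric]
        inner_add_right u_def w_def)
  then have "((- w $ 2) * q1 - (- q2) * w $ 1) / (q1 * q1) * p1 + u $ 1 * (- q2 / q1) + u $ 2 = D x t"
    using \<open>q1 < 0\<close>
    by (simp add: inner_real2 d_def \<Lambda>_def p1_q1_q2_def[symmetric] field_simps)
  ultimately show ?thesis
    by (simp add: \<psi>_def[abs_def] d_def inner_real2)
qed

text \<open>A feasible point near the graph lies on it or to its right. Sliding it horizontally onto
  the graph does not raise \<open>g x\<close> and lands on the value
  \<open>G x (z $ 2)\<close>.\<close>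

lemma local_minimizer_lift:
  assumes x: "x \<in> {0..1}" and t: "t \<in> {-6<..<6}" and "e > 0"
    and min: "\<And>w. \<bar>w - t\<bar> < e \<Longrightarrow> G x t \<le> G x w"
  shows "\<exists>r>0. \<forall>z \<in> ball (Y x t) r. h x z \<le> 0 \<longrightarrow> g x (Y x t) \<le> g x z"
proof -
  \<comment> \<open>The radius keeps the ball inside the strip where the monotonicity lemmas hold,
    and \<open>z $ 2\<close> within \<open>e\<close> of \<open>t\<close>.\<close>
  define r where "r = Min {e, 6 - t, 6 + t, 1/2 - \<phi> x t, 1/2 + \<phi> x t}"
  have r: "r > 0" "r \<le> e" "r \<le> 6 - t" "r \<le> 6 + t" "r \<le> 1/2 - \<phi> x t" "r \<le> 1/2 + \<phi> x t"
    using \<open>e > 0\<close> t \<phi>(1)[of x t] x by (auto simp: r_def)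
  have "g x (Y x t) \<le> g x z" if "z \<in> ball (Y x t) r" "h x z \<le> 0" for z
  proof -
    have "dist (Y x t $ i) (z $ i) < r" for i
      using dist_vec_nth_le[of "Y x t" i z] that(1) by simp
    from this[of 1] this[of 2] have "\<bar>z $ 1 - \<phi> x t\<bar> < r" "\<bar>z $ 2 - t\<bar> < r"
      by (auto simp: dist_real_def)
    then have z: "\<bar>z $ 2 - t\<bar> < e" "z $ 2 \<in> {-6..6}" "z $ 1 \<in> {-1/2..1/2}"
      using r by auto
    have "G x t \<le> G x (z $ 2)" by (rule min) fact
    also have "\<dots> \<le> g x z"
    proof -
      have "\<phi> x (z $ 2) \<le> z $ 1"
        using feasible_imp_ge_\<phi>[OF x z(2,3)] that(2) by simp
      then show ?thesis
        using g_increasing[OF x z(2), of "\<phi> x (z $ 2)" "z $ 1"] \<phi>(1)[OF x z(2)] z(3)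
        by (cases "\<phi> x (z $ 2) = z $ 1") (auto simp: G_def Y_def)
    qed
    finally show ?thesis by (simp add: G_def)
  qed
  with r(1) show ?thesis by blast
qed

text \<open>The first coordinate of \<open>p + \<Lambda> q\<close> vanishes by the choice of
  \<open>\<Lambda>\<close>, and the second equals \<open>\<psi> x t\<close>. Critical points of
  \<open>G x\<close> are therefore stationary for the Lagrangian.\<close>

lemma multiplier:
  assumes "x \<in> {0..1}" "t \<in> {-6..6}"
  shows "\<Lambda> x t > 0" "q x (Y x t) \<bullet> d x t = 0"
    "\<psi> x t = 0 \<Longrightarrow> p x (Y x t) + \<Lambda> x t *\<^sub>R q x (Y x t) = 0"
  using gradients_Y[OF assms]
  by (auto simp: \<Lambda>_def d_def \<psi>_def inner_real2 vec_eq_iff forall_2 field_simps)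

lemma norm_d: "(norm (d x t))\<^sup>2 \<ge> 1"
  unfolding power2_norm_eq_inner by (simp add: inner_real2 d_def)

lemma hessian_lagrangian:
  assumes "x \<in> {0..1}"
  shows "hessian (\<lambda>z. g x z + c * h x z) y = A x y + c *\<^sub>R B x y"
proof (rule hessian_eq)
  show "GDERIV (\<lambda>z. g x z + c * h x z) z :> p x z + c *\<^sub>R q x z" for z
    using GDERIV_g[OF assms, of z] GDERIV_h[OF assms, of z]
    by (auto simp: gderiv_def inner_add_right intro!: derivative_eq_intros)
  show "((\<lambda>z. p x z + c *\<^sub>R q x z) has_derivative (\<lambda>v. (A x y + c *\<^sub>R B x y) *v v)) (at y)"
    using deriv_p[OF assms, of y] deriv_q[OF assms, of y]
    by (auto simp: matrix_vector_mult_add_rdistrib scaleR_matrix_vector_assoc[symmetric] intro!: derivative_eq_intros)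
qed

end

section \<open>The perturbed problem\<close>

lemma C2_small_bounds:
  assumes "C2_family X f p H" "C2_small \<epsilon> K X f" "x \<in> X" "y \<in> K"
  shows "\<bar>f x y\<bar> \<le> \<epsilon>" "\<bar>p x y $ i\<bar> \<le> \<epsilon>" "\<bar>v \<bullet> (H x y *v v)\<bar> \<le> \<epsilon> * (norm v)\<^sup>2"
proof -
  have small: "\<bar>f x y\<bar> \<le> \<epsilon>" "norm (p x y) \<le> \<epsilon>" "onorm (\<lambda>d. H x y *v d) \<le> \<epsilon>"
    using assms unfolding C2_small_def
    by (auto simp: C2_family_grad[OF assms(1,3)] C2_family_hessian[OF assms(1,3)] dest!: bspec)
  show "\<bar>f x y\<bar> \<le> \<epsilon>" by fact
  show "\<bar>p x y $ i\<bar> \<le> \<epsilon>" using component_le_norm_cart[of "p x y" i] small(2) by simp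
  have "norm (H x y *v v) \<le> onorm (\<lambda>d. H x y *v d) * norm v"
    by (rule onorm) simp
  also have "\<dots> \<le> \<epsilon> * norm v" using small(3) by (rule mult_right_mono) simp
  finally have "norm v * norm (H x y *v v) \<le> norm v * (\<epsilon> * norm v)"
    by (rule mult_left_mono) simp
  then show "\<bar>v \<bullet> (H x y *v v)\<bar> \<le> \<epsilon> * (norm v)\<^sup>2"
    using Cauchy_Schwarz_ineq2[of v "H x y *v v"] by (simp add: power2_eq_square ac_simps)
qed

section \<open>Derivatives of the unperturbed data\<close>

definition g0_gradient :: "real \<Rightarrow> real^2 \<Rightarrow> real^2" where
  "g0_gradient x y = pt (2 * (y $ 1 + 1)) (0.4 * x * (y $ 2)^3 + 2 * (1 - 6 * x) * y $ 2)"

definition g0_hessian :: "real \<Rightarrow> real^2 \<Rightarrow> real^2^2" where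
  "g0_hessian x y =
    (\<chi> i j. if i \<noteq> j then 0 else if i = 1 then 2 else 1.2 * x * (y $ 2)\<^sup>2 + 2 * (1 - 6 * x))"

lemma g0_hessian_mult:
  "g0_hessian x y *v v = pt (2 * v $ 1) ((1.2 * x * (y $ 2)\<^sup>2 + 2 * (1 - 6 * x)) * v $ 2)"
  by (simp add: vec_eq_iff forall_2 matrix_vector_mult_def sum_2 g0_hessian_def)

lemma has_derivative_pt:
  assumes "(a has_derivative a') F" "(b has_derivative b') F"
  shows "((\<lambda>z. pt (a z) (b z)) has_derivative (\<lambda>v. pt (a' v) (b' v))) F"
  unfolding pt_def
  by (intro has_derivative_add has_derivative_scaleR_left assms)

lemma C2_family_g0: "C2_family X g0 g0_gradient g0_hessian"
  unfolding C2_family_def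
proof (intro conjI ballI allI)
  fix x y
  have [derivative_intros]: "((\<lambda>y. y $ i) has_derivative (\<lambda>v. v $ i)) (at y)" for i and y :: "real^2"
    by (rule bounded_linear_imp_has_derivative[OF bounded_linear_vec_nth])
  show "GDERIV (g0 x) y :> g0_gradient x y"
    unfolding gderiv_def g0_def[abs_def] g0_gradient_def
    by (auto intro!: derivative_eq_intros simp: inner_real2 algebra_simps)
  show "(g0_gradient x has_derivative (\<lambda>d. g0_hessian x y *v d)) (at y)"
    unfolding g0_hessian_mult g0_gradient_def[abs_def]
    by (intro has_derivative_pt) (auto intro!: derivative_eq_intros simp: algebra_simps power2_eq_square)
next
  show "continuous_on (X \<times> UNIV) (\<lambda>(x, y). g0 x y)"
    unfolding g0_def split_def by (intro continuous_intros)
  show "continuous_on (X \<times> UNIV) (\<lambda>(x, y). g0_gradient x y)"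
    unfolding g0_gradient_def split_def by (intro continuous_intros)
  have "continuous_on (X \<times> UNIV) (\<lambda>z. if b then 0 else if c then 2 else 1.2 * fst z * (snd z $ 2)\<^sup>2 + 2 * (1 - 6 * fst z))"
    for b c and X :: "real set"
    by (cases b; cases c) (auto intro!: continuous_intros)
  then show "continuous_on (X \<times> UNIV) (\<lambda>(x, y). g0_hessian x y)"
    unfolding g0_hessian_def split_def by (intro continuous_on_vec_lambda) auto
qed

lemma C2_family_h0_1: "C2_family X (h0 1) (\<lambda>x y. pt (-1) 0) (\<lambda>x y. 0)"
proof -
  have "h0 1 x = (\<lambda>y. - y $ 1)" for x by (auto simp: h0_def)
  moreover have "((\<lambda>y. - y $ 1) has_derivative (\<lambda>v. - v $ 1)) (at y)" for y :: "real^2"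
    by (intro has_derivative_minus bounded_linear_imp_has_derivative bounded_linear_vec_nth)
  ultimately show ?thesis
    by (auto simp: C2_family_def gderiv_def inner_real2 split_def intro!: continuous_intros)
qed

text \<open>The unperturbed feasible rectangle enlarged by \<open>1\<close> on each side; it also
  covers the strip around \<open>y $ 1 = 0\<close>.\<close>

definition K0 :: "(real^2) set" where
  "K0 = cbox (pt (-1) (-7)) (pt 3 7)"

lemma mem_K0: "pt a t \<in> K0" if "a \<in> {-1/2..1/2}" "t \<in> {-6..6}"
  using that by (simp add: K0_def mem_box_cart forall_2)

text \<open>Derivatives are named for \<open>s\<close> and \<open>r 1\<close>, which enter the
  reduced problem; the values of the other \<open>r i\<close> serve to keep their constraints
  inactive.\<close>

locale small_perturbation =
  fixes s :: "real \<Rightarrow> real^2 \<Rightarrow> real" and r :: "4 \<Rightarrow> real \<Rightarrow> real^2 \<Rightarrow> real"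
    and ps pr :: "real \<Rightarrow> real^2 \<Rightarrow> real^2" and Hs Hr :: "real \<Rightarrow> real^2 \<Rightarrow> real^2^2"
  assumes s: "C2_family {0..1} s ps Hs" "C2_small (1/10) K0 {0..1} s"
    and r1: "C2_family {0..1} (r 1) pr Hr"
    and r: "\<And>i. C2_small (1/10) K0 {0..1} (r i)"
begin

lemmas s_bounds = C2_small_bounds[OF s]
lemmas r1_bounds = C2_small_bounds[OF r1 r]

definition pg :: "real \<Rightarrow> real^2 \<Rightarrow> real^2" where
  "pg x y = g0_gradient x y + ps x y"

definition qh :: "real \<Rightarrow> real^2 \<Rightarrow> real^2" where
  "qh x y = pt (-1) 0 + pr x y"

definition Hg :: "real \<Rightarrow> real^2 \<Rightarrow> real^2^2" where
  "Hg x y = g0_hessian x y + Hs x y"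

sublocale reduced_problem "\<lambda>x y. g0 x y + s x y" "\<lambda>x y. h0 1 x y + r 1 x y" pg qh Hg Hr
proof
  show "C2_family {0..1} (\<lambda>x y. g0 x y + s x y) pg Hg"
    unfolding pg_def[abs_def] Hg_def[abs_def] by (intro C2_family_add C2_family_g0 s)
  show "C2_family {0..1} (\<lambda>x y. h0 1 x y + r 1 x y) qh Hr"
    using C2_family_add[OF C2_family_h0_1 r1] by (simp add: qh_def[abs_def])
next
  fix x a t :: real
  assume "x \<in> {0..1}" and at: "a \<in> {-1/2..1/2}" "t \<in> {-6..6}"
  \<comment> \<open>On the strip \<open>2 * (a + 1) \<ge> 1\<close>, and the unperturbed constraint
    gradient has first entry \<open>-1\<close>; a change by \<open>1/10\<close> affects neither
    sign.\<close>
  then show "pg x (pt a t) $ 1 > 0 \<and> qh x (pt a t) $ 1 < 0"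
    using s_bounds(2)[of x "pt a t" 1] r1_bounds(2)[of x "pt a t" 1] mem_K0[OF at]
    by (auto simp: pg_def qh_def g0_gradient_def)
next
  fix x t :: real
  assume "x \<in> {0..1}" "t \<in> {-6..6}"
  then show "h0 1 x (pt (-1/2) t) + r 1 x (pt (-1/2) t) > 0 \<and> h0 1 x (pt (1/2) t) + r 1 x (pt (1/2) t) < 0"
    using r1_bounds(1)[of x "pt (-1/2) t"] r1_bounds(1)[of x "pt (1/2) t"]
      mem_K0[of "-1/2" t] mem_K0[of "1/2" t] by (auto simp: h0_def)
qed

section \<open>Size estimates for the reduced problem\<close>

lemma Y_in_K0: "x \<in> {0..1} \<Longrightarrow> t \<in> {-6..6} \<Longrightarrow> Y x t \<in> K0"
  unfolding Y_def using \<phi>(1)[of x t] by (intro mem_K0) auto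

text \<open>The slope is at most \<open>(1/10) / (9/10)\<close>, the objective's first derivative at
  most \<open>2 * (3/2) + 1/10\<close>, and their analogue for \<open>\<Lambda>\<close> is
  \<open>(31/10) / (9/10)\<close>, which is below \<open>4\<close>.\<close>

lemma first_components:
  assumes "x \<in> {0..1}" "t \<in> {-6..6}"
  shows "\<bar>d x t $ 1\<bar> \<le> 1/9" "\<bar>2 * (\<phi> x t + 1) + ps x (Y x t) $ 1\<bar> \<le> 31/10" "\<Lambda> x t \<le> 4"
proof -
  define p1 q1 q2 where "p1 = ps x (Y x t) $ 1" "q1 = pr x (Y x t) $ 1" "q2 = pr x (Y x t) $ 2"
  have b: "\<bar>p1\<bar> \<le> 1/10" "\<bar>q1\<bar> \<le> 1/10" "\<bar>q2\<bar> \<le> 1/10"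
    using s_bounds(2)[of x "Y x t" 1] r1_bounds(2)[of x "Y x t"] Y_in_K0[OF assms] assms
    unfolding p1_q1_q2_def by auto
  have \<phi>': "-1/2 < \<phi> x t" "\<phi> x t < 1/2" using \<phi>(1)[OF assms] by auto
  show "\<bar>2 * (\<phi> x t + 1) + ps x (Y x t) $ 1\<bar> \<le> 31/10"
    using \<phi>' b by (auto simp: p1_q1_q2_def[symmetric])
  show "\<bar>d x t $ 1\<bar> \<le> 1/9"
    using b by (auto simp: d_def qh_def p1_q1_q2_def[symmetric] abs_le_iff field_simps)
  have "2 * (\<phi> x t + 1) + p1 \<le> 4 * (1 - q1)" using b \<phi>' by auto
  then show "\<Lambda> x t \<le> 4"
    using b by (auto simp: \<Lambda>_def pg_def qh_def g0_gradient_def p1_q1_q2_def[symmetric] field_simps)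
qed

text \<open>The cubic is the derivative of the unperturbed objective along the edge
  \<open>y $ 1 = 0\<close>. The error is at most \<open>1/9 * (31/10) + 1/10 = 4/9\<close>.\<close>

lemma \<psi>_approx:
  assumes "x \<in> {0..1}" "t \<in> {-6..6}"
  shows "\<bar>\<psi> x t - (0.4 * x * t^3 + 2 * (1 - 6 * x) * t)\<bar> \<le> 1/2"
proof -
  have "\<psi> x t - (0.4 * x * t^3 + 2 * (1 - 6 * x) * t) =
      d x t $ 1 * (2 * (\<phi> x t + 1) + ps x (Y x t) $ 1) + ps x (Y x t) $ 2"
    by (simp add: \<psi>_def inner_real2 pg_def g0_gradient_def d_def)
  moreover have "\<bar>d x t $ 1 * (2 * (\<phi> x t + 1) + ps x (Y x t) $ 1)\<bar> \<le> 1/9 * (31/10)"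
    unfolding abs_mult using first_components[OF assms] by (intro mult_mono) auto
  moreover have "\<bar>ps x (Y x t) $ 2\<bar> \<le> 1/10"
    using s_bounds(2) Y_in_K0 assms by blast
  ultimately show ?thesis by linarith
qed

text \<open>At \<open>x = 0\<close> the unperturbed Hessian is twice the identity. The perturbations
  of objective and constraint cost at most \<open>1/10\<close> and \<open>4 * (1/10)\<close> times
  the squared norm, which leaves a positive multiple.\<close>

lemma D_0_pos:
  assumes t: "t \<in> {-6..6}"
  shows "D 0 t > 0"
proof -
  define v where "v = d 0 t"
  have "v \<bullet> (g0_hessian 0 (Y 0 t) *v v) = 2 * (norm v)\<^sup>2"
    unfolding power2_norm_eq_inner by (simp add: g0_hessian_mult inner_real2)
  moreover have "\<bar>v \<bullet> (Hs 0 (Y 0 t) *v v)\<bar> \<le> 1/10 * (norm v)\<^sup>2"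
    using s_bounds(3) Y_in_K0 t by simp
  moreover have "\<bar>\<Lambda> 0 t * (v \<bullet> (Hr 0 (Y 0 t) *v v))\<bar> \<le> 4 * (1/10 * (norm v)\<^sup>2)"
    unfolding abs_mult using r1_bounds(3)[of 0 "Y 0 t" v] Y_in_K0 t first_components(3) multiplier(1)[of 0 t]
    by (intro mult_mono) auto
  moreover have "D 0 t = v \<bullet> (g0_hessian 0 (Y 0 t) *v v) + v \<bullet> (Hs 0 (Y 0 t) *v v) +
      \<Lambda> 0 t * (v \<bullet> (Hr 0 (Y 0 t) *v v))"
    by (simp add: D_def v_def Hg_def matrix_vector_mult_add_rdistrib inner_add_right
        scaleR_matrix_vector_assoc[symmetric])
  moreover have "(norm v)\<^sup>2 \<ge> 1"
    unfolding v_def by (rule norm_d)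
  ultimately show ?thesis by linarith
qed

text \<open>This supplies the hypothesis \<open>nondeg\<close> with \<open>m = \<sigma>\<close>: the
  second-order condition at \<open>Y x t\<close> in direction \<open>d x t\<close> bounds
  \<open>D x t\<close> from below, and \<open>norm_d\<close> removes the factor
  \<open>(norm (d x t))\<^sup>2\<close>.\<close>

lemma uniform_SOSC_imp_D_ge:
  assumes SOSC: "\<And>y \<mu> v. KKT_pair (\<lambda>x y. g0 x y + s x y) (\<lambda>i x y. h0 i x y + r i x y) x y \<mu> \<Longrightarrow>
      local_minimizer (\<lambda>x y. g0 x y + s x y) (\<lambda>i x y. h0 i x y + r i x y) x y \<Longrightarrow>
      v \<in> critical_cone (\<lambda>i x y. h0 i x y + r i x y) x y \<mu> \<Longrightarrow>
      v \<bullet> (hessian (\<lambda>z. lagrangian (\<lambda>x y. g0 x y + s x y) (\<lambda>i x y. h0 i x y + r i x y) x z \<mu>) y *v v)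
        \<ge> \<sigma> * (norm v)\<^sup>2"
    and "\<sigma> > 0" and x: "x \<in> {0..1}" and t: "\<bar>t\<bar> < 11/2" and "e > 0"
    and min: "\<And>w. \<bar>w - t\<bar> < e \<Longrightarrow> G x t \<le> G x w"
  shows "D x t \<ge> \<sigma>"
proof -
  let ?g = "\<lambda>x y. g0 x y + s x y" and ?h = "\<lambda>i x y. h0 i x y + r i x y"
  define y where "y = Y x t"
  define \<mu> :: "real^4" where "\<mu> = (\<chi> i. if i = 1 then \<Lambda> x t else 0)"
  have t': "t \<in> {-6<..<6}" "t \<in> {-6..6}" using t by auto
  have y: "y \<in> K0" "y $ 1 = \<phi> x t" "y $ 2 = t" using Y_in_K0[OF x t'(2)] by (auto simp: y_def)
  have active: "?h 1 x y = 0" using \<phi>(2)[OF x t'(2)] by (simp add: y_def Y_def)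
  \<comment> \<open>The unperturbed slack exceeds \<open>3/2\<close> for \<open>i = 2\<close>, as
    \<open>\<phi> x t < 1/2\<close>, and \<open>1/2\<close> for the bounds on \<open>y $ 2\<close>,
    as \<open>\<bar>t\<bar> < 11/2\<close>; both outweigh \<open>1/10\<close>.\<close>
  have inactive: "?h i x y < 0" if "i \<noteq> 1" for i
  proof -
    have "\<bar>r i x y\<bar> \<le> 1/10" using r[of i] x y(1) by (auto simp: C2_small_def)
    then show ?thesis using that \<phi>(1)[OF x t'(2)] t y by (auto simp: h0_def)
  qed
  have feasible: "?h i x y \<le> 0" for i
    using active inactive[of i] by (cases "i = 1") auto
  have crit: "\<psi> x t = 0"
    using DERIV_local_min[OF deriv_G[OF x t'(1)] \<open>e > 0\<close>] min by (simp add: abs_minus_commute)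
  note grads = grad_eq[OF GDERIV_g[OF x]] grad_eq[OF GDERIV_h[OF x]]
  have "KKT_pair ?g ?h x y \<mu>"
    unfolding KKT_pair_def
  proof (intro conjI allI)
    have "(\<Sum>i\<in>UNIV. \<mu> $ i *\<^sub>R grad (?h i x) y) = \<Lambda> x t *\<^sub>R grad (?h 1 x) y"
      by (simp add: \<mu>_def sum_4)
    then show "grad (?g x) y + (\<Sum>i\<in>UNIV. \<mu> $ i *\<^sub>R grad (?h i x) y) = 0"
      using multiplier(3)[OF x t'(2) crit] by (simp add: grads y_def)
    fix i
    show "?h i x y \<le> 0" by (rule feasible)
    show "\<mu> $ i \<ge> 0" "\<mu> $ i * ?h i x y = 0"
      using multiplier(1)[OF x t'(2)] active by (auto simp: \<mu>_def)
  qed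
  \<comment> \<open>Minimality subject to the first constraint alone suffices, since the other
    constraints only shrink the feasible set.\<close>
  moreover have "local_minimizer ?g ?h x y"
  proof -
    obtain \<rho> where "\<rho> > 0" "\<forall>z \<in> ball y \<rho>. ?h 1 x z \<le> 0 \<longrightarrow> ?g x y \<le> ?g x z"
      using local_minimizer_lift[OF x t'(1) \<open>e > 0\<close> min] unfolding y_def by blast
    moreover have "y \<in> feasible ?h x"
      using feasible by (simp add: feasible_def)
    ultimately show ?thesis by (auto simp: local_minimizer_def feasible_def)
  qed
  moreover have "d x t \<in> critical_cone ?h x y \<mu>"
    using multiplier(1,2)[OF x t'(2)] inactive
    by (auto simp: critical_cone_def \<mu>_def grads y_def dest: less_imp_neq)
  moreover have "lagrangian ?g ?h x z \<mu> = ?g x z + \<Lambda> x t * ?h 1 x z" for z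
    by (simp add: lagrangian_def \<mu>_def sum_4)
  ultimately have "\<sigma> * (norm (d x t))\<^sup>2 \<le> D x t"
    using SOSC[of y \<mu> "d x t"] by (simp add: hessian_lagrangian[OF x] D_def y_def)
  moreover have "\<sigma> * 1 \<le> \<sigma> * (norm (d x t))\<^sup>2"
    using \<open>\<sigma> > 0\<close> norm_d by (intro mult_left_mono) auto
  ultimately show ?thesis by simp
qed

lemma not_uniform_SOSC:
  "\<not> uniform_SOSC {0..1} (\<lambda>x y. g0 x y + s x y) (\<lambda>i x y. h0 i x y + r i x y)"
proof
  assume "uniform_SOSC {0..1} (\<lambda>x y. g0 x y + s x y) (\<lambda>i x y. h0 i x y + r i x y)"
  then obtain \<sigma> where "\<sigma> > 0"
    and SOSC: "\<And>x y \<mu> v. x \<in> {0..1} \<Longrightarrow>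
      KKT_pair (\<lambda>x y. g0 x y + s x y) (\<lambda>i x y. h0 i x y + r i x y) x y \<mu> \<Longrightarrow>
      local_minimizer (\<lambda>x y. g0 x y + s x y) (\<lambda>i x y. h0 i x y + r i x y) x y \<Longrightarrow>
      v \<in> critical_cone (\<lambda>i x y. h0 i x y + r i x y) x y \<mu> \<Longrightarrow>
      v \<bullet> (hessian (\<lambda>z. lagrangian (\<lambda>x y. g0 x y + s x y) (\<lambda>i x y. h0 i x y + r i x y) x z \<mu>) y *v v)
        \<ge> \<sigma> * (norm v)\<^sup>2"
    unfolding uniform_SOSC_def by blast
  \<comment> \<open>The unperturbed wells satisfy \<open>\<bar>t\<bar> \<le> 5\<close>; at
    \<open>t = l\<close> the unperturbed derivative is \<open>11 + 0.55 * x\<close>, well above the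
    error \<open>1/2\<close>. At the same time \<open>l\<close> stays \<open>1/2\<close> away from
    the bounds on \<open>y $ 2\<close>.\<close>
  define l :: real where "l = 11/2"
  have sub: "{0..1} \<times> {-l..l} \<subseteq> {0..1} \<times> {-6..6}" by (auto simp: l_def)
  show False
  proof (rule no_uniformly_nondegenerate_family[of l G \<psi> D "-1" 1 \<sigma>])
    fix x t :: real assume "x \<in> {0..1}" "t \<in> {-l..l}"
    then show "(G x has_real_derivative \<psi> x t) (at t)" "(\<psi> x has_real_derivative D x t) (at t)"
      by (auto intro!: deriv_G deriv_\<psi> simp: l_def)
  next
    fix x :: real assume x: "x \<in> {0..1}"
    show "\<psi> x (-l) < 0 \<and> \<psi> x l > 0"
      using \<psi>_approx[OF x, of "-l", unfolded abs_le_iff] \<psi>_approx[OF x, of l, unfolded abs_le_iff] x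
      by (simp add: l_def power3_eq_cube algebra_simps)
  next
    \<comment> \<open>For \<open>x = 1\<close> the unperturbed derivative is
      \<open>0.4 * t^3 - 10 * t\<close>, with values \<open>9.6\<close> at \<open>-1\<close> and
      \<open>-9.6\<close> at \<open>1\<close>: the central hump of the double well.\<close>
    show "\<psi> 1 (-1) > 0" "\<psi> 1 1 < 0"
      using \<psi>_approx[of 1 "-1", unfolded abs_le_iff] \<psi>_approx[of 1 1, unfolded abs_le_iff] by auto
  next
    fix x t e :: real
    assume "x \<in> {0..1}" "-l < t" "t < l" "e > 0" "\<And>w. \<bar>w - t\<bar> < e \<Longrightarrow> G x t \<le> G x w"
    then show "\<sigma> \<le> D x t"
      by (intro uniform_SOSC_imp_D_ge[OF SOSC \<open>\<sigma> > 0\<close>, of x t e]) (auto simp: l_def abs_less_iff)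
  next
    show "continuous_on ({0..1} \<times> {-l..l}) (\<lambda>(x, t). \<psi> x t)"
      "continuous_on ({0..1} \<times> {-l..l}) (\<lambda>(x, t). D x t)"
      by (rule continuous_on_subset[OF _ sub], rule continuous_reduced)+
  qed (use \<open>\<sigma> > 0\<close> in \<open>auto simp: l_def intro!: D_0_pos\<close>)
qed

end

theorem mainTheorem10:
  shows "\<exists>(K :: (real^2) set) (\<epsilon> :: real).
    compact K \<and> {y. y$1 \<in> {0..2} \<and> y$2 \<in> {-6..6}} \<subseteq> interior K \<and> \<epsilon> > 0 \<and>
    (\<forall>(s :: real \<Rightarrow> real^2 \<Rightarrow> real) (r :: 4 \<Rightarrow> real \<Rightarrow> real^2 \<Rightarrow> real).
      C2_on ({0..1} \<times> UNIV) (\<lambda>(x, y). s x y) \<longrightarrow>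
      (\<forall>i. C2_on ({0..1} \<times> UNIV) (\<lambda>(x, y). r i x y)) \<longrightarrow>
      C2_small \<epsilon> K {0..1} s \<longrightarrow>
      (\<forall>i. C2_small \<epsilon> K {0..1} (r i)) \<longrightarrow>
      \<not> uniform_SOSC {0..1} (\<lambda>x y. g0 x y + s x y) (\<lambda>i x y. h0 i x y + r i x y))"
proof (intro exI[of _ K0] exI[of _ "1/10"] conjI allI impI)
  show "compact K0" by (simp add: K0_def compact_cbox)
  show "{y. y$1 \<in> {0..2} \<and> y$2 \<in> {-6..6}} \<subseteq> interior K0"
    by (auto simp: K0_def interior_cbox mem_box_cart forall_2)
  show "(1/10 :: real) > 0" by simp
next
  fix s :: "real \<Rightarrow> real^2 \<Rightarrow> real" and r :: "4 \<Rightarrow> real \<Rightarrow> real^2 \<Rightarrow> real"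
  assume "C2_on ({0..1} \<times> UNIV) (\<lambda>(x, y). s x y)"
    and r: "\<forall>i. C2_on ({0..1} \<times> UNIV) (\<lambda>(x, y). r i x y)"
    and small: "C2_small (1/10) K0 {0..1} s" "\<forall>i. C2_small (1/10) K0 {0..1} (r i)"
  then obtain ps Hs where "C2_family {0..1} s ps Hs"
    using C2_on_imp_C2_family by blast
  moreover obtain pr Hr where "C2_family {0..1} (r 1) pr Hr"
    using C2_on_imp_C2_family r by blast
  ultimately interpret small_perturbation s r ps pr Hs Hr
    using small by unfold_locales auto
  show "\<not> uniform_SOSC {0..1} (\<lambda>x y. g0 x y + s x y) (\<lambda>i x y. h0 i x y + r i x y)"
    by (rule not_uniform_SOSC)
qed

end
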